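(* Let $n\ge 1$ and let \[ \lambda=(L_1^{m_1},L_2^{m_2},\dots,L_r^{m_r})\vdash n,\qquad L_1>\cdots>L_r>0, \] and let $g_i=L_i-L_{i+1}$ for $1\le i\le r$, with $L_{r+1}:=0$. Set $s:=n-T_r$, where $T_r=\frac{r(r+1)}{2}$. Then \[ \sum_{j=1}^r j\,\mathbf 1_{g_j>1}+\sum_{i=1}^r (r+1-i)\,\mathbf 1_{m_i>1}\le s. \]
   Context: The notation $\lambda=(L_1^{m_1},\dots,L_r^{m_r})\vdash n$ with $L_1>\cdots>L_r>0$ means that $\lambda$ is the partition of $n$ whose distinct part sizes are exactly the positive integers $L_1,\dots,L_r$, where $L_i$ occurs with multiplicity $m_i\ge 1$. For a condition $P$, $\mathbf 1_P$ equals $1$ if $P$ holds and $0$ otherwise. *)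

theory Defs
  imports Main "HOL-Library.Multiset"
begin

definition is_partition :: "nat multiset \<Rightarrow> nat \<Rightarrow> bool" where
  "is_partition lam n \<longleftrightarrow> 0 \<notin># lam \<and> \<Sum>\<^sub># lam = n"

text \<open>The notation \<open>lam = (L\<^sub>1^m\<^sub>1, \<dots>, L\<^sub>r^m\<^sub>r)\<close> with \<open>L\<^sub>1 > \<dots> > L\<^sub>r > 0\<close>; only the values of
  \<open>L\<close> and \<open>m\<close> on \<open>{1..r}\<close> are relevant.\<close>
definition frequency_notation ::
    "nat multiset \<Rightarrow> nat \<Rightarrow> (nat \<Rightarrow> nat) \<Rightarrow> (nat \<Rightarrow> nat) \<Rightarrow> bool" where
  "frequency_notation lam r L m \<longleftrightarrow>
     set_mset lam = L ` {1..r} \<and>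
     (\<forall>i\<in>{1..r}. L i > 0 \<and> m i \<ge> 1 \<and> count lam (L i) = m i) \<and>
     (\<forall>i\<in>{1..r}. \<forall>j\<in>{1..r}. i < j \<longrightarrow> L i > L j)"

definition triangular :: "nat \<Rightarrow> nat" where
  "triangular r = r * (r + 1) div 2"

end

theory Submission
  imports Defs
begin

text \<open>
  Write \<open>n = (\<Sum>i. L i) + (\<Sum>i. (m i - 1) * L i)\<close>. Since \<open>L (r + 1) = 0\<close>,
  summation by parts gives \<open>(\<Sum>i. L i) = (\<Sum>j. j * g j)\<close>, and \<open>triangular r = (\<Sum>j. j)\<close>, so
  \<open>s = (\<Sum>j. j * (g j - 1)) + (\<Sum>i. (m i - 1) * L i)\<close>.
  The two sums in the theorem are bounded termwise by these two: the gaps \<open>g j\<close> and the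
  multiplicities \<open>m i\<close> are at least \<open>1\<close>, and \<open>L i \<ge> r + 1 - i\<close>, because \<open>L\<close> is strictly
  decreasing with positive values (\<open>strictly_decreasing_lower_bound\<close>).
\<close>

lemma sum_by_parts:
  fixes f :: "nat \<Rightarrow> int"
  shows "(\<Sum>i=1..r. f i) = (\<Sum>j=1..r. int j * (f j - f (j + 1))) + int r * f (r + 1)"
  by (induction r) (simp_all add: algebra_simps)

lemma triangular_eq_sum: "triangular r = (\<Sum>j=1..r. j)"
  unfolding triangular_def by (induction r) simp_all

lemma strictly_decreasing_lower_bound:
  fixes f :: "nat \<Rightarrow> nat"
  assumes "i \<le> r + 1" and "1 \<le> i" and "\<And>k. k \<in> {1..r} \<Longrightarrow> f (k + 1) < f k"
  shows "r + 1 - i \<le> f i"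
  using assms(1)
proof (induction rule: inc_induct)
  case base
  then show ?case by simp
next
  case (step k)
  then have "f (k + 1) < f k"
    using assms(2) by (intro assms(3)) simp
  with step show ?case by simp
qed

text \<open>Summing over any finite superset \<open>S\<close> of the support, instead of the support itself, keeps
  the index set fixed in the induction on \<open>M\<close>.\<close>
lemma sum_mset_eq_sum_count:
  fixes M :: "nat multiset"
  assumes "finite S" and "set_mset M \<subseteq> S"
  shows "\<Sum>\<^sub># M = (\<Sum>x\<in>S. count M x * x)"
  using assms(2)
proof (induction M)
  case empty
  show ?case by simp
next
  case (add a M)
  have "(\<Sum>x\<in>S. count (add_mset a M) x * x)
      = (\<Sum>x\<in>S. count M x * x + (if x = a then x else 0))"
    by (intro sum.cong) simp_all
  also have "\<dots> = \<Sum>\<^sub># M + a"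
    using add assms(1) by (simp add: sum.distrib)
  finally show ?case by simp
qed

lemma frequency_notation_sum:
  assumes "frequency_notation lam r L m"
  shows "\<Sum>\<^sub># lam = (\<Sum>i=1..r. m i * L i)"
proof -
  have parts: "set_mset lam = L ` {1..r}"
    and mult: "\<And>i. i \<in> {1..r} \<Longrightarrow> count lam (L i) = m i"
    and decr: "\<And>i j. i \<in> {1..r} \<Longrightarrow> j \<in> {1..r} \<Longrightarrow> i < j \<Longrightarrow> L j < L i"
    using assms unfolding frequency_notation_def by blast+
  have inj: "inj_on L {1..r}"
    by (rule linorder_inj_onI) (use decr in force)+
  have "\<Sum>\<^sub># lam = (\<Sum>x\<in>set_mset lam. count lam x * x)"
    by (rule sum_mset_eq_sum_count) simp_all
  also have "\<dots> = (\<Sum>i=1..r. count lam (L i) * L i)"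
    unfolding parts by (subst sum.reindex[OF inj]) simp
  also have "\<dots> = (\<Sum>i=1..r. m i * L i)"
    using mult by (intro sum.cong) simp_all
  finally show ?thesis .
qed

theorem proposition3p2:
  fixes n r :: nat and lam :: "nat multiset" and L m :: "nat \<Rightarrow> nat"
    and g :: "nat \<Rightarrow> int" and s :: int
  assumes "n \<ge> 1"
    and "is_partition lam n"
    and "frequency_notation lam r L m"
    and "L (r + 1) = 0"
    and "\<And>i. i \<in> {1..r} \<Longrightarrow> g i = int (L i) - int (L (i + 1))"
    and "s = int n - int (triangular r)"
  shows "(\<Sum>j=1..r. int j * of_bool (g j > 1))
       + (\<Sum>i=1..r. (int r + 1 - int i) * of_bool (m i > 1)) \<le> s"
proof -
  have pos: "L i > 0" "m i \<ge> 1" if "i \<in> {1..r}" for i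
    using assms(3) that unfolding frequency_notation_def by blast+
  have step: "L (i + 1) < L i" if i: "i \<in> {1..r}" for i
  proof (cases "i = r")
    case True
    then show ?thesis using pos(1)[OF i] assms(4) by simp
  next
    case False
    then have "i + 1 \<in> {1..r}" using i by auto
    then show ?thesis
      using assms(3) i less_add_one unfolding frequency_notation_def by blast
  qed
  have lower: "int r + 1 - int i \<le> int (L i)" if "i \<in> {1..r}" for i
    using strictly_decreasing_lower_bound[of i r L] that step by force
  have "int n = (\<Sum>i=1..r. int (m i) * int (L i))"
    using assms(2) frequency_notation_sum[OF assms(3)] unfolding is_partition_def
    by (simp flip: of_nat_mult of_nat_sum)
  also have "\<dots> = (\<Sum>i=1..r. int (L i)) + (\<Sum>i=1..r. (int (m i) - 1) * int (L i))"
    by (simp add: algebra_simps flip: sum.distrib)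
  also have "(\<Sum>i=1..r. int (L i)) = (\<Sum>j=1..r. int j * g j)"
    using sum_by_parts[of "\<lambda>i. int (L i)" r] assms(4,5) by simp
  finally have s_eq:
    "s = (\<Sum>j=1..r. int j * (g j - 1)) + (\<Sum>i=1..r. (int (m i) - 1) * int (L i))"
    unfolding assms(6) triangular_eq_sum by (simp add: algebra_simps sum_subtractf)
  have "(\<Sum>j=1..r. int j * of_bool (g j > 1)) \<le> (\<Sum>j=1..r. int j * (g j - 1))"
  proof (rule sum_mono)
    fix j assume j: "j \<in> {1..r}"
    then have "of_bool (g j > 1) \<le> g j - 1"
      using step[OF j] assms(5)[OF j] by (simp add: of_bool_def)
    then show "int j * of_bool (g j > 1) \<le> int j * (g j - 1)"
      by (rule mult_left_mono) simp
  qed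
  moreover have "(\<Sum>i=1..r. (int r + 1 - int i) * of_bool (m i > 1))
      \<le> (\<Sum>i=1..r. (int (m i) - 1) * int (L i))"
  proof (rule sum_mono)
    fix i assume i: "i \<in> {1..r}"
    have "of_bool (m i > 1) \<le> int (m i) - 1"
      using pos(2)[OF i] by (simp add: of_bool_def)
    then have "(int r + 1 - int i) * of_bool (m i > 1) \<le> int (L i) * (int (m i) - 1)"
      by (intro mult_mono lower[OF i]) simp_all
    then show "(int r + 1 - int i) * of_bool (m i > 1) \<le> (int (m i) - 1) * int (L i)"
      by (simp add: mult.commute)
  qed
  ultimately show ?thesis
    unfolding s_eq by (rule add_mono)
qed

end
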